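(* Let $k>0$. For $\lambda,\rho,v,c\in\mathbb{C}$ with $\Re\left(\frac{v}{k}\right)>-1$, $\Re(\lambda+\rho)>0$, $\Re\left(\lambda+\frac{v}{k}\right)>0$ and $z>0$ (where $z$ is the variable of integration), the following holds, $y$ being a parameter: $$\int_{0}^{1}z^{\lambda+\rho-1}(1-z)^{2\lambda-1}\left(1-\frac{z}{3}\right)^{2(\lambda+\rho)-1}\left(1-\frac{z}{4}\right)^{\lambda-1}W_{v,c}^{k}\left(\frac{y\left(1-\frac{z}{4}\right)(1-z)^2}{2}\right)dz$$ $$=\frac{\left(\frac{y}{2}\right)^{v/k}\,\Gamma(\lambda+\rho)\left(\frac{2}{3}\right)^{2(\lambda+\rho)}}{k^{v/k}}\;{}_1\Psi_{2}\left[\begin{array}{c}\left(\lambda+\frac{v}{k},2\right)\\ \left(\frac{v}{k}+1,1\right),\ \left(2\lambda+\frac{v}{k}+\rho,2\right)\end{array};\ -\frac{c\,y^2}{4k}\right].$$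
   Context: The $k$-gamma function is $\Gamma_k(s)=\int_0^\infty t^{s-1}e^{-t^k/k}\,dt$, and satisfies $\Gamma_k(s)=k^{\frac{s}{k}-1}\Gamma(s/k)$, where $\Gamma$ is the gamma function. The generalized $k$-Bessel function is given, for $k>0$, by $$W_{v,c}^{k}(x)=\sum_{n=0}^{\infty}\frac{(-c)^n}{\Gamma_k(nk+v+k)\,n!}\left(\frac{x}{2}\right)^{2n+\frac{v}{k}}.$$ The Wright-type hypergeometric function is $${}_1\Psi_2\left[\begin{array}{c}(\alpha_1,A_1)\\(\beta_1,B_1),(\beta_2,B_2)\end{array};x\right]=\sum_{n=0}^\infty\frac{\Gamma(\alpha_1+A_1n)}{\Gamma(\beta_1+B_1n)\Gamma(\beta_2+B_2n)}\frac{x^n}{n!}.$$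
   Formalization: The argument of W is taken as y(1-z/4)(1-z)^2, without the printed division by 2; as printed the formula is false (k=v=λ=1, c=ρ=0 gives y/18 on the left and y/9 on the right). Powers are principal, with 0^w=0 also for w=0 (matters only at y=0). *)

theory Defs
  imports "HOL-Analysis.Analysis"
begin

text \<open>
  Complex powers are taken on the principal branch (\<open>powr\<close>). The library puts \<open>0 powr w = 0\<close> for
  every \<open>w\<close>, including \<open>w = 0\<close>.
\<close>

text \<open>The integral converges (absolutely) for \<open>k > 0\<close> and \<open>Re s > 0\<close>; other values are not meaningful.\<close>

definition k_Gamma :: "real \<Rightarrow> complex \<Rightarrow> complex" where
  "k_Gamma k s =
     integral {0..} (\<lambda>t. complex_of_real t powr (s - 1) * complex_of_real (exp (- (t powr k) / k)))"

definition k_Bessel :: "real \<Rightarrow> complex \<Rightarrow> complex \<Rightarrow> complex \<Rightarrow> complex" where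
  "k_Bessel k v c x =
     (\<Sum>n. (- c) ^ n / (k_Gamma k (of_nat n * of_real k + v + of_real k) * fact n)
           * (x / 2) powr (2 * of_nat n + v / of_real k))"

text \<open>
  Since \<open>Gamma\<close> is \<open>0\<close> at its poles in the library and \<open>1 / 0 = 0\<close>, the reciprocal Gamma factors
  have their usual value \<open>0\<close> there.
\<close>

fun wright_1Psi2 ::
  "complex \<times> real \<Rightarrow> complex \<times> real \<Rightarrow> complex \<times> real \<Rightarrow> complex \<Rightarrow> complex" where
  "wright_1Psi2 (\<alpha>1, A1) (\<beta>1, B1) (\<beta>2, B2) x =
     (\<Sum>n. Gamma (\<alpha>1 + of_real A1 * of_nat n)
           / (Gamma (\<beta>1 + of_real B1 * of_nat n) * Gamma (\<beta>2 + of_real B2 * of_nat n))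
           * (x ^ n / fact n))"

text \<open>
  A normalisation pitfall: \<open>k_Bessel k v c x\<close> is a series in \<open>x / 2\<close>. The integral formula is
  sometimes printed with \<open>y (1 - z / 4) (1 - z)\<^sup>2 / 2\<close> as the argument of the \<open>k\<close>-Bessel function and
  with \<open>(y / 2) powr (v / k)\<close> and \<open>- c y\<^sup>2 / (4 k)\<close> on the right. That version counts the factor \<open>1 / 2\<close> twice
  and is false: for \<open>k = v = lam = 1\<close>, \<open>c = \<rho> = 0\<close> the two sides are \<open>y / 18\<close> and \<open>y / 9\<close>. The
  argument that matches this right-hand side is \<open>y (1 - z / 4) (1 - z)\<^sup>2\<close>.
\<close>

end

theory Submission
  imports Defs
begin

text \<open>
  The cubic substitution \<open>u = (9/4) z (1 - z/3)\<^sup>2\<close> maps \<open>(0, 1)\<close> increasingly onto itself and satisfies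
  \<open>1 - u = (1 - z/4) (1 - z)\<^sup>2\<close> and \<open>du = (9/4) (1 - z) (1 - z/3) dz\<close>. It therefore turns the
  algebraic factors of the integrand into \<open>(2/3)\<close> to the power \<open>2 (lam + \<rho>)\<close> times the Beta kernel
  \<open>u\<close> to the power \<open>lam + \<rho> - 1\<close>, \<open>1 - u\<close> to the power \<open>lam - 1\<close>, and the argument of the
  \<open>k\<close>-Bessel function into \<open>y (1 - u)\<close>. The Bessel series is then integrated term by term against
  this kernel (dominated convergence, since its coefficients are absolutely summable), and each term
  is a complex Beta integral.
\<close>

section \<open>Gamma integrals and the k-Gamma function\<close>

text \<open>With positive real bases, identities between complex powers become linear identities
  between exponents; the substitutions below are all verified this way.\<close>

lemma powr_of_real_eq_exp:
  assumes "x > 0"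
  shows "complex_of_real x powr s = exp (s * of_real (ln x))"
  using assms by (simp add: powr_def Ln_of_real)

text \<open>Substituting \<open>u = c * t powr p\<close> in Euler's integral at \<open>s / p\<close>
  gives this integrand up to the constant \<open>p * c powr (s / p)\<close>. The case
  \<open>p = k\<close>, \<open>c = 1 / k\<close> is the k-Gamma function, and \<open>p = 1\<close>
  is the scaled Gamma integral.\<close>

lemma Gamma_integral_powr:
  fixes s :: complex and p c :: real
  assumes "p > 0" "c > 0" "Re s > 0"
  shows "(\<lambda>t. of_real t powr (s - 1) * of_real (exp (- (c * t powr p)))) absolutely_integrable_on {0<..}"
    and "integral {0<..} (\<lambda>t. of_real t powr (s - 1) * of_real (exp (- (c * t powr p))))
         = Gamma (s / p) / (p * of_real c powr (s / p))"
proof -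
  define f where "f = (\<lambda>t. complex_of_real t powr (s / p - 1) / of_real (exp t))"
  define h where "h = (\<lambda>t. complex_of_real t powr (s - 1) * of_real (exp (- (c * t powr p))))"
  define C where "C = p * of_real c powr (s / p)"
  have C: "C \<noteq> 0" using assms by (auto simp: C_def)
  have img: "(\<lambda>t. c * t powr p) ` {0<..} = {0<..}"
  proof safe
    fix u :: real assume "u > 0"
    then have "u = c * ((u / c) powr (1 / p)) powr p" "(u / c) powr (1 / p) \<in> {0<..}"
      using assms by (simp_all add: powr_powr)
    then show "u \<in> (\<lambda>t. c * t powr p) ` {0<..}" by (rule image_eqI)
  qed (use assms in auto)
  have inj: "inj_on (\<lambda>t. c * t powr p) {0<..}"
    using assms by (intro inj_on_inverseI[where g = "\<lambda>u. (u / c) powr (1 / p)"]) (simp add: powr_powr)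
  have s: "Re (s / p) > 0" using assms by (simp add: Re_divide_of_real)
  have "(\<lambda>t. \<bar>c * p * t powr (p - 1)\<bar> *\<^sub>R f (c * t powr p)) absolutely_integrable_on {0<..} \<and>
        integral {0<..} (\<lambda>t. \<bar>c * p * t powr (p - 1)\<bar> *\<^sub>R f (c * t powr p)) = Gamma (s / p)
      \<longleftrightarrow> f absolutely_integrable_on (\<lambda>t. c * t powr p) ` {0<..} \<and>
        integral ((\<lambda>t. c * t powr p) ` {0<..}) f = Gamma (s / p)"
    by (rule has_absolute_integral_change_of_variables_real[OF _ _ inj])
       (auto intro!: derivative_eq_intros)
  also have "\<dots>" unfolding img f_def
    using absolutely_integrable_Gamma_integral'[OF s] Gamma_integral_complex'[OF s]
    by (auto simp: integral_unique)
  finally have *: "(\<lambda>t. \<bar>c * p * t powr (p - 1)\<bar> *\<^sub>R f (c * t powr p)) absolutely_integrable_on {0<..}"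
    "integral {0<..} (\<lambda>t. \<bar>c * p * t powr (p - 1)\<bar> *\<^sub>R f (c * t powr p)) = Gamma (s / p)" by auto
  \<comment> \<open>The exponents add up to \<open>(p - 1) + p * (s / p - 1) = s - 1\<close> for
    \<open>t\<close> and to \<open>1 + (s / p - 1) = s / p\<close> for \<open>c\<close>.\<close>
  have eq: "\<bar>c * p * t powr (p - 1)\<bar> *\<^sub>R f (c * t powr p) = C * h t" if "t \<in> {0<..}" for t
  proof -
    have t: "t > 0" using that by simp
    define L X where "L = ln c + p * ln t" and "X = ln c + (p - 1) * ln t"
    have pos: "c * t powr p > 0" using t assms by simp
    have "\<bar>c * p * t powr (p - 1)\<bar> = p * exp X"
      using t assms by (simp add: X_def powr_def exp_add abs_mult)
    moreover have "ln (c * t powr p) = L"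
      using t assms by (simp add: L_def ln_mult ln_powr)
    then have "f (c * t powr p) = exp ((s / p - 1) * of_real L) * of_real (exp (- (c * t powr p)))"
      unfolding f_def powr_of_real_eq_exp[OF pos] by (simp add: exp_minus field_simps)
    moreover have "exp (complex_of_real X) * exp ((s / p - 1) * of_real L) =
        exp (s / p * of_real (ln c)) * exp ((s - 1) * of_real (ln t))"
      using assms unfolding L_def X_def exp_add[symmetric]
      by (intro arg_cong[of _ _ exp]) (simp add: field_simps)
    ultimately show ?thesis
      unfolding C_def h_def powr_of_real_eq_exp[OF t] powr_of_real_eq_exp[OF assms(2)]
      by (simp add: scaleR_conv_of_real mult_ac flip: exp_of_real)
  qed
  have "(\<lambda>t. C * h t) absolutely_integrable_on {0<..}"
    using *(1) by (rule iffD1[OF set_integrable_cong, OF refl refl, rotated]) (rule eq)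
  from set_integrable_mult_right[OF this, of "inverse C"]
  show "(\<lambda>t. complex_of_real t powr (s - 1) * of_real (exp (- (c * t powr p))))
          absolutely_integrable_on {0<..}"
    using C by (simp add: h_def[symmetric])
  have "integral {0<..} (\<lambda>t. C * h t) = Gamma (s / p)"
    unfolding *(2)[symmetric] by (rule integral_cong) (simp only: eq)
  then have "C * integral {0<..} h = Gamma (s / p)"
    by simp
  then show "integral {0<..} (\<lambda>t. of_real t powr (s - 1) * of_real (exp (- (c * t powr p))))
         = Gamma (s / p) / (p * of_real c powr (s / p))"
    using C by (simp add: h_def C_def field_simps)
qed

lemma k_Gamma_eq:
  assumes "k > 0" "Re s > 0"
  shows "k_Gamma k s = of_real k powr (s / of_real k - 1) * Gamma (s / of_real k)"
proof -
  have "k_Gamma k s = integral {0<..} (\<lambda>t. of_real t powr (s - 1) * of_real (exp (- ((1 / k) * t powr k))))"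
    \<comment> \<open>Removing the endpoint \<open>0\<close>, a null set, allows the formula on the
      open half-line to be applied.\<close>
    unfolding k_Gamma_def
    by (simp, rule integral_spike_set) (auto intro: negligible_subset[of "{0}"])
  also have "\<dots> = Gamma (s / k) / (k * of_real (1 / k) powr (s / k))"
    using assms by (intro Gamma_integral_powr) auto
  moreover have "1 / (k * of_real (1 / k) powr (s / k)) = of_real k powr (s / of_real k - 1)"
  proof -
    have "1 / k > 0" using assms by simp
    moreover have "of_real k powr (s / of_real k - 1) = of_real k powr (s / of_real k) / of_real k"
      using assms by (simp add: powr_diff)
    ultimately show ?thesis
      using assms unfolding powr_of_real_eq_exp[OF \<open>1 / k > 0\<close>] powr_of_real_eq_exp[OF assms(1)]
      by (simp add: ln_div exp_minus field_simps)
  qed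
  ultimately show ?thesis by (simp add: divide_inverse)
qed

text \<open>The case \<open>p = 1\<close>, restated as a Bochner integral over \<open>lborel\<close>
  so that Fubini's theorem on the product measure can use it.\<close>

lemma has_bochner_integral_Gamma_scaled:
  assumes "c > 0" "Re s > 0"
  shows "has_bochner_integral lborel
           (\<lambda>t. indicator {0<..} t *\<^sub>R (complex_of_real t powr (s - 1) * of_real (exp (- (c * t)))))
           (Gamma s / of_real c powr s)"
proof -
  define f where "f = (\<lambda>t. complex_of_real t powr (s - 1) * of_real (exp (- (c * t))))"
  define h where "h = (\<lambda>t. indicator {0<..} t *\<^sub>R f t)"
  have *: "f absolutely_integrable_on {0<..} \<longleftrightarrow>
      (\<lambda>t. complex_of_real t powr (s - 1) * of_real (exp (- (c * t powr 1)))) absolutely_integrable_on {0<..}"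
    unfolding f_def by (rule set_integrable_cong) auto
  have f: "f absolutely_integrable_on {0<..}"
    unfolding * using Gamma_integral_powr(1)[of 1 c s] assms by simp
  have "integral {0<..} f =
      integral {0<..} (\<lambda>t. complex_of_real t powr (s - 1) * of_real (exp (- (c * t powr 1))))"
    unfolding f_def by (rule integral_cong) auto
  then have I: "integral {0<..} f = Gamma s / of_real c powr s"
    using Gamma_integral_powr(2)[of 1 c s] assms by simp
  \<comment> \<open>Absolute integrability refers to the completed measure; Borel measurability is
    what brings the integral back to \<open>lborel\<close>.\<close>
  have m: "h \<in> borel_measurable lborel"
    unfolding h_def f_def
    by (auto intro!: borel_measurable_continuous_on_indicator continuous_intros)
  have "integrable lborel h"
    using f m unfolding set_integrable_def h_def[symmetric] by (simp add: integrable_completion)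
  moreover have "integral\<^sup>L lborel h = Gamma s / of_real c powr s"
    using set_lebesgue_integral_eq_integral(2)[OF f] m I
    unfolding set_lebesgue_integral_def h_def[symmetric] by (simp add: integral_completion)
  ultimately show ?thesis
    unfolding has_bochner_integral_iff h_def f_def by simp
qed

text \<open>The real part of the complex formula at a real exponent; it evaluates the integrals of
  norms needed for Fubini.\<close>

lemma has_bochner_integral_Gamma_scaled_real:
  fixes c s :: real
  assumes "c > 0" "s > 0"
  shows "has_bochner_integral lborel
           (\<lambda>t. indicator {0<..} t * (t powr (s - 1) * exp (- (c * t)))) (Gamma s / c powr s)"
proof -
  have "has_bochner_integral lborel
      (\<lambda>t. Re (indicator {0<..} t *\<^sub>R (complex_of_real t powr (of_real s - 1) * of_real (exp (- (c * t))))))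
      (Re (Gamma (of_real s) / of_real c powr of_real s))"
    by (intro has_bochner_integral_bounded_linear[OF bounded_linear_Re]
              has_bochner_integral_Gamma_scaled) (use assms in auto)
  moreover have "Re (indicator {0<..} t *\<^sub>R (complex_of_real t powr (of_real s - 1) * of_real (exp (- (c * t)))))
      = indicator {0<..} t * (t powr (s - 1) * exp (- (c * t)))" for t
    using powr_of_real[of t "s - 1"] by (cases "t > 0") auto
  moreover have "Re (Gamma (of_real s) / of_real c powr of_real s) = Gamma s / c powr s"
    using assms by (simp add: Gamma_complex_of_real powr_of_real flip: of_real_divide)
  ultimately show ?thesis by (simp only:)
qed

section \<open>The Beta integral with complex parameters\<close>

lemma not_nonpos_Int_of_Re_pos: "Re z > 0 \<Longrightarrow> z \<notin> \<int>\<^sub>\<le>\<^sub>0"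
  by (auto elim!: nonpos_Ints_cases)

text \<open>
  Both iterated integrals of \<open>t\<close> to the power \<open>a + b - 1\<close> times \<open>u\<close> to the power \<open>a - 1\<close> times
  \<open>exp (- t (1 + u))\<close> are Gamma integrals: integrating over \<open>u\<close> first gives \<open>Gamma a * Gamma b\<close>,
  over \<open>t\<close> first gives \<open>Gamma (a + b)\<close> times the integral below.
\<close>

lemma has_bochner_integral_Beta_halfline:
  fixes a b :: complex
  assumes "Re a > 0" "Re b > 0"
  shows "has_bochner_integral lborel
           (\<lambda>u. indicator {0<..} u *\<^sub>R (of_real u powr (a - 1) / of_real (1 + u) powr (a + b))) (Beta a b)"
proof -
  define F where "F = (\<lambda>(t, u). indicator ({0<..} \<times> {0<..}) (t, u) *\<^sub>R
    (complex_of_real t powr (a + b - 1) * of_real u powr (a - 1) * of_real (exp (- (t * (1 + u))))))"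
  \<comment> \<open>One factorisation of the kernel per order of integration: a factor free of the
    inner variable times a scaled Gamma integrand.\<close>
  have F_t: "F (t, u) = indicator {0<..} t *\<^sub>R (of_real t powr (a + b - 1) * of_real (exp (- t))) *
      (indicator {0<..} u *\<^sub>R (of_real u powr (a - 1) * of_real (exp (- (t * u)))))" for t u
    by (auto simp: F_def indicator_def exp_diff exp_minus ring_distribs exp_add field_simps)
  have F_u: "F (t, u) = indicator {0<..} u *\<^sub>R (of_real u powr (a - 1)) *
      (indicator {0<..} t *\<^sub>R (of_real t powr (a + b - 1) * of_real (exp (- ((1 + u) * t)))))" for t u
    by (auto simp: F_def indicator_def mult_ac)
  have inner_t: "has_bochner_integral lborel (\<lambda>u. F (t, u))
      (indicator {0<..} t *\<^sub>R (Gamma a * (of_real t powr (b - 1) * of_real (exp (- t)))))" for t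
  proof (cases "t > 0")
    case True
    have "has_bochner_integral lborel (\<lambda>u. F (t, u))
        (indicator {0<..} t *\<^sub>R (of_real t powr (a + b - 1) * of_real (exp (- t))) *
        (Gamma a / of_real t powr a))"
      unfolding F_t using True assms
      by (intro has_bochner_integral_mult_right has_bochner_integral_Gamma_scaled)
    then show ?thesis using True
      by (simp add: powr_diff powr_add mult_ac)
  qed (simp add: F_t has_bochner_integral_zero)
  \<comment> \<open>Taking norms replaces \<open>a\<close> and \<open>b\<close> by their real parts,
    so the inner integral of the norm is again a Gamma integrand in \<open>t\<close>, hence
    integrable. This is the hypothesis of Fubini's theorem.\<close>
  have norm_F: "norm (F (t, u)) = indicator {0<..} t * (t powr (Re (a + b) - 1) * exp (- t)) *
      (indicator {0<..} u * (u powr (Re a - 1) * exp (- (t * u))))" for t u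
    by (auto simp: F_t indicator_def norm_mult norm_powr_real_powr)
  have "has_bochner_integral lborel (\<lambda>u. norm (F (t, u)))
      (indicator {0<..} t * (Gamma (Re a) * (t powr (Re b - 1) * exp (- t))))" for t
  proof (cases "t > 0")
    case True
    have "has_bochner_integral lborel (\<lambda>u. norm (F (t, u)))
        (indicator {0<..} t * (t powr (Re (a + b) - 1) * exp (- t)) *
        (Gamma (Re a) / t powr Re a))"
      unfolding norm_F using True assms
      by (intro has_bochner_integral_mult_right has_bochner_integral_Gamma_scaled_real)
    then show ?thesis using True
      by (simp add: powr_diff powr_add mult_ac)
  qed (simp add: norm_F has_bochner_integral_zero)
  then have norm_int: "(\<integral>u. norm (F (t, u)) \<partial>lborel) =
      Gamma (Re a) * (indicator {0<..} t * (t powr (Re b - 1) * exp (- (1 * t))))" for t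
    by (simp add: has_bochner_integral_iff)
  have meas: "F \<in> borel_measurable (lborel \<Otimes>\<^sub>M lborel)"
    unfolding F_def lborel_prod case_prod_unfold
    by (auto intro!: borel_measurable_continuous_on_indicator continuous_intros
        simp: borel_open open_Times)
  have int: "integrable (lborel \<Otimes>\<^sub>M lborel) F"
  proof (rule lborel_pair.Fubini_integrable[OF meas])
    show "integrable lborel (\<lambda>t. \<integral>u. norm (F (t, u)) \<partial>lborel)"
      unfolding norm_int
      using has_bochner_integral_Gamma_scaled_real[of 1 "Re b"] assms
      by (intro integrable_mult_right) (simp add: has_bochner_integral_iff)
    show "AE t in lborel. integrable lborel (\<lambda>u. F (t, u))"
      using inner_t by (simp add: has_bochner_integral_iff)
  qed
  define G where "G = (\<lambda>u. indicator {0<..} u *\<^sub>R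
    (complex_of_real u powr (a - 1) / of_real (1 + u) powr (a + b)))"
  have inner_u: "(\<integral>t. F (t, u) \<partial>lborel) = Gamma (a + b) * G u" for u
  proof (cases "u > 0")
    case True
    have "has_bochner_integral lborel (\<lambda>t. F (t, u))
        (indicator {0<..} u *\<^sub>R (of_real u powr (a - 1)) *
        (Gamma (a + b) / of_real (1 + u) powr (a + b)))"
      unfolding F_u using True assms
      by (intro has_bochner_integral_mult_right has_bochner_integral_Gamma_scaled) auto
    then show ?thesis using True
      by (simp add: has_bochner_integral_iff G_def mult.commute)
  qed (simp add: F_u G_def)
  have nz: "Gamma (a + b) \<noteq> 0"
    using not_nonpos_Int_of_Re_pos[of "a + b"] assms by (simp add: Gamma_eq_zero_iff)
  have "integrable lborel (\<lambda>u. \<integral>t. F (t, u) \<partial>lborel)"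
    using lborel_pair.integrable_snd[of "\<lambda>t u. F (t, u)"] int by simp
  then have "integrable lborel (\<lambda>u. inverse (Gamma (a + b)) * (Gamma (a + b) * G u))"
    unfolding inner_u by (rule integrable_mult_right)
  then have "integrable lborel G"
    using nz by (simp flip: mult.assoc)
  moreover have "integral\<^sup>L lborel G = Beta a b"
  proof -
    have "Gamma (a + b) * integral\<^sup>L lborel G = (\<integral>u. (\<integral>t. F (t, u) \<partial>lborel) \<partial>lborel)"
      unfolding inner_u by simp
    also have "\<dots> = (\<integral>t. (\<integral>u. F (t, u) \<partial>lborel) \<partial>lborel)"
      using lborel_pair.Fubini_integral[of "\<lambda>t u. F (t, u)"] int by simp
    also have "\<dots> = (\<integral>t. Gamma a * (indicator {0<..} t *\<^sub>R (of_real t powr (b - 1) * of_real (exp (- (1 * t))))) \<partial>lborel)"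
      by (rule Bochner_Integration.integral_cong)
         (use inner_t in \<open>auto simp: has_bochner_integral_iff\<close>)
    also have "\<dots> = Gamma a * Gamma b"
    proof (intro has_bochner_integral_integral_eq has_bochner_integral_mult_right)
      show "has_bochner_integral lborel (\<lambda>t. indicator {0<..} t *\<^sub>R
          (complex_of_real t powr (b - 1) * of_real (exp (- (1 * t))))) (Gamma b)"
        using has_bochner_integral_Gamma_scaled[of 1 b] assms by simp
    qed
    finally show ?thesis using nz by (simp add: Beta_def field_simps)
  qed
  ultimately show ?thesis
    by (simp add: has_bochner_integral_iff G_def)
qed

text \<open>Substitute \<open>u = t / (1 - t)\<close> in the half-line form:
  \<open>1 + u = 1 / (1 - t)\<close> and \<open>du = dt / (1 - t)^2\<close>, so the exponent of
  \<open>1 - t\<close> becomes \<open>-2 - (a - 1) + (a + b) = b - 1\<close>.\<close>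

lemma Beta_integral_complex:
  fixes a b :: complex
  assumes "Re a > 0" "Re b > 0"
  shows "(\<lambda>t. of_real t powr (a - 1) * of_real (1 - t) powr (b - 1)) absolutely_integrable_on {0<..<1}"
    and "integral {0<..<1} (\<lambda>t. of_real t powr (a - 1) * of_real (1 - t) powr (b - 1)) = Beta a b"
proof -
  define f where "f = (\<lambda>u. complex_of_real u powr (a - 1) / of_real (1 + u) powr (a + b))"
  define h where "h = (\<lambda>t. complex_of_real t powr (a - 1) * of_real (1 - t) powr (b - 1))"
  have f: "f absolutely_integrable_on {0<..}" "integral {0<..} f = Beta a b"
  proof -
    have *: "has_bochner_integral lborel (\<lambda>u. indicator {0<..} u *\<^sub>R f u) (Beta a b)"
      unfolding f_def by (rule has_bochner_integral_Beta_halfline) fact+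
    then have m: "(\<lambda>u. indicator {0<..} u *\<^sub>R f u) \<in> borel_measurable lborel"
      by (auto simp: has_bochner_integral_iff)
    with * show **: "f absolutely_integrable_on {0<..}"
      by (simp add: set_integrable_def integrable_completion has_bochner_integral_iff)
    show "integral {0<..} f = Beta a b"
      using set_lebesgue_integral_eq_integral(2)[OF **] m *
      by (simp add: set_lebesgue_integral_def integral_completion has_bochner_integral_iff)
  qed
  define g where "g = (\<lambda>t::real. t / (1 - t))"
  have img: "g ` {0<..<1} = {0<..}"
  proof safe
    fix u :: real assume "u > 0"
    then have "u = g (u / (1 + u))" "u / (1 + u) \<in> {0<..<1}"
      by (simp_all add: g_def field_simps)
    then show "u \<in> g ` {0<..<1}" by (rule image_eqI)
  qed (auto simp: g_def)
  have inj: "inj_on g {0<..<1}"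
    by (intro inj_on_inverseI[where g = "\<lambda>u. u / (1 + u)"]) (simp add: g_def field_simps)
  have "(\<lambda>t. \<bar>1 / (1 - t)\<^sup>2\<bar> *\<^sub>R f (g t)) absolutely_integrable_on {0<..<1} \<and>
        integral {0<..<1} (\<lambda>t. \<bar>1 / (1 - t)\<^sup>2\<bar> *\<^sub>R f (g t)) = Beta a b
      \<longleftrightarrow> f absolutely_integrable_on g ` {0<..<1} \<and> integral (g ` {0<..<1}) f = Beta a b"
    by (rule has_absolute_integral_change_of_variables_real[OF _ _ inj])
       (auto simp: g_def field_simps power2_eq_square intro!: derivative_eq_intros)
  with f have *: "(\<lambda>t. \<bar>1 / (1 - t)\<^sup>2\<bar> *\<^sub>R f (g t)) absolutely_integrable_on {0<..<1}"
      "integral {0<..<1} (\<lambda>t. \<bar>1 / (1 - t)\<^sup>2\<bar> *\<^sub>R f (g t)) = Beta a b"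
    unfolding img by auto
  have eq: "\<bar>1 / (1 - t)\<^sup>2\<bar> *\<^sub>R f (g t) = h t" if "t \<in> {0<..<1}" for t
  proof -
    have t: "t > 0" "1 - t > 0" using that by auto
    have "1 + g t = 1 / (1 - t)" using t by (simp add: g_def field_simps)
    then have ln: "ln (g t) = ln t - ln (1 - t)" "ln (1 + g t) = - ln (1 - t)"
      using t by (simp_all add: g_def ln_div)
    have pos: "g t > 0" "1 + g t > 0" using t by (simp_all add: g_def add_pos_pos)
    have "(1 - t)\<^sup>2 = exp (2 * ln (1 - t))"
      using t by (simp add: exp_double)
    then have "\<bar>1 / (1 - t)\<^sup>2\<bar> = exp (- 2 * ln (1 - t))"
      by (simp add: exp_minus field_simps)
    then have "\<bar>1 / (1 - t)\<^sup>2\<bar> *\<^sub>R f (g t)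
        = exp (complex_of_real (- 2 * ln (1 - t)) + (a - 1) * of_real (ln t - ln (1 - t))
               - (a + b) * of_real (- ln (1 - t)))"
      unfolding f_def powr_of_real_eq_exp[OF pos(1)] powr_of_real_eq_exp[OF pos(2)] ln
      by (simp only: scaleR_conv_of_real exp_of_real[symmetric] exp_add exp_diff times_divide_eq_right)
    also have "\<dots> = exp ((a - 1) * of_real (ln t) + (b - 1) * of_real (ln (1 - t)))"
      by (rule arg_cong[of _ _ exp]) (simp add: algebra_simps)
    also have "\<dots> = h t"
      unfolding h_def powr_of_real_eq_exp[OF t(1)] powr_of_real_eq_exp[OF t(2)] by (simp only: exp_add)
    finally show ?thesis .
  qed
  show "(\<lambda>t. complex_of_real t powr (a - 1) * of_real (1 - t) powr (b - 1))
          absolutely_integrable_on {0<..<1}"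
    unfolding h_def[symmetric]
    using *(1) by (rule iffD1[OF set_integrable_cong, OF refl refl, rotated]) (rule eq)
  show "integral {0<..<1} (\<lambda>t. complex_of_real t powr (a - 1) * of_real (1 - t) powr (b - 1)) = Beta a b"
    unfolding h_def[symmetric] *(2)[symmetric] by (rule integral_cong) (simp only: eq)
qed

section \<open>The k-Bessel series and its termwise integration\<close>

text \<open>Ratio test: by the Gamma recurrence consecutive terms have ratio
  \<open>X / ((w + 1 + n) * (n + 1))\<close>. The bound on \<open>Re w\<close> keeps every Gamma
  argument in the right half-plane.\<close>

lemma summable_k_Bessel_coeff:
  fixes X w :: complex
  assumes "Re w > -1"
  defines "a \<equiv> \<lambda>n. X ^ n / (Gamma (w + 1 + of_nat n) * fact n)"
  shows "summable (\<lambda>n. norm (a n))"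
proof -
  \<comment> \<open>For \<open>n \<ge> N\<close> the denominator of the ratio has norm at least
    \<open>n \<ge> 2 * norm X\<close>, which gives the factor \<open>1 / 2\<close>.\<close>
  obtain N :: nat where N: "real N \<ge> 2 * norm X + 1"
    using real_arch_simple by blast
  show "summable (\<lambda>n. norm (a n))"
  proof (rule summable_ratio_test[where c = "1/2" and N = N])
    fix n assume n: "n \<ge> N"
    have Re: "Re (w + 1 + of_nat n) \<ge> n" "Re (w + 1 + of_nat n) > 0"
      using assms by auto
    then have nz: "w + 1 + of_nat n \<noteq> 0" by (metis less_irrefl zero_complex.sel(1))
    have "Gamma (w + 1 + of_nat (Suc n)) = (w + 1 + of_nat n) * Gamma (w + 1 + of_nat n)"
      using Gamma_plus1[of "w + 1 + of_nat n"] not_nonpos_Int_of_Re_pos[OF Re(2)]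
      by (simp add: add_ac)
    then have "a (Suc n) = X / ((w + 1 + of_nat n) * of_nat (Suc n)) * a n"
      by (simp add: a_def)
    then have *: "norm (a (Suc n)) = norm X / (norm (w + 1 + of_nat n) * real (Suc n)) * norm (a n)"
      by (simp add: norm_mult norm_divide del: of_nat_Suc)
    have "2 * norm X \<le> n" using n N by (simp add: order_trans[of _ "real N"])
    also have "\<dots> \<le> norm (w + 1 + of_nat n)"
      using Re(1) complex_Re_le_cmod order_trans by blast
    also have "\<dots> \<le> norm (w + 1 + of_nat n) * real (Suc n)"
      using mult_left_mono[of 1 "real (Suc n)" "norm (w + 1 + of_nat n)"] by simp
    finally have "norm X / (norm (w + 1 + of_nat n) * real (Suc n)) \<le> 1 / 2"
      using nz by (simp add: divide_le_eq del: of_nat_Suc)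
    then have "norm (a (Suc n)) \<le> 1 / 2 * norm (a n)"
      unfolding * by (rule mult_right_mono) simp
    then show "norm (norm (a (Suc n))) \<le> 1 / 2 * norm (norm (a n))"
      by simp
  qed simp
qed

text \<open>The factor \<open>(1 - u) ^ (2 * n)\<close> shifts the second Beta parameter by
  \<open>2 * n\<close>. On \<open>(0, 1)\<close> it is at most \<open>1\<close>, so all partial sums
  lie below \<open>M\<close> times the real Beta kernel, and dominated convergence applies.\<close>

lemma Beta_series_integral:
  fixes \<alpha> \<beta> :: complex and a :: "nat \<Rightarrow> complex"
  assumes \<alpha>: "Re \<alpha> > 0" and \<beta>: "Re \<beta> > 0" and a: "summable (\<lambda>n. norm (a n))"
  defines "F \<equiv> \<lambda>u. of_real u powr (\<alpha> - 1) * of_real (1 - u) powr (\<beta> - 1)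
                  * (\<Sum>n. a n * of_real (1 - u) ^ (2 * n))"
  shows "F absolutely_integrable_on {0<..<1}"
    and "(\<lambda>n. a n * Beta \<alpha> (\<beta> + 2 * of_nat n)) sums integral {0<..<1} F"
proof -
  define b where "b = (\<lambda>u. complex_of_real u powr (\<alpha> - 1) * of_real (1 - u) powr (\<beta> - 1))"
  define f where "f = (\<lambda>N u. b u * (\<Sum>n<N. a n * of_real (1 - u) ^ (2 * n)))"
  define M where "M = (\<Sum>n. norm (a n))"
  define h where "h = (\<lambda>u. M * (u powr (Re \<alpha> - 1) * (1 - u) powr (Re \<beta> - 1)))"
  have int_term: "((\<lambda>u. a n * (b u * of_real (1 - u) ^ (2 * n))) has_integral
      a n * Beta \<alpha> (\<beta> + 2 * of_nat n)) {0<..<1}" for n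
  proof (rule has_integral_mult_right)
    have pos: "Re (\<beta> + 2 * of_nat n) > 0" using \<beta> by (simp add: add_pos_nonneg)
    have "((\<lambda>u. of_real u powr (\<alpha> - 1) * of_real (1 - u) powr (\<beta> + 2 * of_nat n - 1)) has_integral
        Beta \<alpha> (\<beta> + 2 * of_nat n)) {0<..<1}"
      using set_lebesgue_integral_eq_integral(1)[OF Beta_integral_complex(1)[OF \<alpha> pos]]
        Beta_integral_complex(2)[OF \<alpha> pos]
      by (simp only: has_integral_iff)
    then show "((\<lambda>u. b u * of_real (1 - u) ^ (2 * n)) has_integral Beta \<alpha> (\<beta> + 2 * of_nat n)) {0<..<1}"
    proof (rule has_integral_eq[rotated])
      fix u :: real assume "u \<in> {0<..<1}"
      then have u: "complex_of_real (1 - u) \<noteq> 0" by (simp del: of_real_diff)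
      have "\<beta> + 2 * of_nat n - 1 = (\<beta> - 1) + of_nat (2 * n)" by simp
      then have "complex_of_real (1 - u) powr (\<beta> + 2 * of_nat n - 1)
          = of_real (1 - u) powr (\<beta> - 1) * of_real (1 - u) ^ (2 * n)"
        using u by (simp only: powr_add powr_nat' simp_thms)
      then show "complex_of_real u powr (\<alpha> - 1) * of_real (1 - u) powr (\<beta> + 2 * of_nat n - 1)
          = b u * of_real (1 - u) ^ (2 * n)"
        by (simp add: b_def)
    qed
  qed
  have f: "(f N has_integral (\<Sum>n<N. a n * Beta \<alpha> (\<beta> + 2 * of_nat n))) {0<..<1}" for N
    unfolding f_def sum_distrib_left mult.left_commute[of "b u" for u]
    by (intro has_integral_sum int_term) simp
  have summ: "summable (\<lambda>n. norm (a n * of_real (1 - u) ^ (2 * n)))"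
    and bound: "norm (a n * of_real (1 - u) ^ (2 * n)) \<le> norm (a n)"
    if "u \<in> {0<..<1}" for u :: real and n
  proof -
    have *: "norm (a n * of_real (1 - u) ^ (2 * n)) \<le> norm (a n)" for n
      using that by (simp add: norm_mult norm_power mult_left_le power_le_one del: of_real_diff)
    then show "norm (a n * of_real (1 - u) ^ (2 * n)) \<le> norm (a n)" .
    show "summable (\<lambda>n. norm (a n * of_real (1 - u) ^ (2 * n)))"
      by (rule summable_comparison_test'[OF a, of 0]) (use * in simp)
  qed
  have nb: "norm (b u) = u powr (Re \<alpha> - 1) * (1 - u) powr (Re \<beta> - 1)" if "u \<in> {0<..<1}" for u
    using that by (simp add: b_def norm_mult norm_powr_real_powr del: of_real_diff)
  have h: "h integrable_on {0<..<1}"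
    unfolding h_def using integrable_Beta'[of "Re \<alpha>" "Re \<beta>"] \<alpha> \<beta>
    by (intro integrable_on_mult_right) (simp add: integrable_on_Icc_iff_Ioo)
  have f_le: "norm (f N u) \<le> h u" if u: "u \<in> {0<..<1}" for N u
  proof -
    have "norm (\<Sum>n<N. a n * of_real (1 - u) ^ (2 * n)) \<le> (\<Sum>n<N. norm (a n))"
      by (rule sum_norm_le) (rule bound[OF u])
    also have "\<dots> \<le> M" unfolding M_def by (rule sum_le_suminf[OF a]) auto
    finally show ?thesis
      unfolding f_def h_def norm_mult nb[OF u] mult.commute[of M] by (rule mult_left_mono) simp
  qed
  have lim: "(\<lambda>N. f N u) \<longlonglongrightarrow> F u" if "u \<in> {0<..<1}" for u
    unfolding f_def F_def b_def
    by (intro tendsto_mult tendsto_const summable_LIMSEQ summable_norm_cancel[OF summ[OF that]])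
  \<comment> \<open>The bound passes to the limit and upgrades integrability of \<open>F\<close> to
    absolute integrability, which the change of variables requires.\<close>
  have F_le: "norm (F u) \<le> h u" if "u \<in> {0<..<1}" for u
    by (rule LIMSEQ_le_const2[OF tendsto_norm[OF lim[OF that]]]) (use f_le[OF that] in blast)
  note dc = dominated_convergence[of f "{0<..<1}" h F, OF has_integral_integrable[OF f] h f_le lim]
  show "F absolutely_integrable_on {0<..<1}"
    by (rule absolutely_integrable_integrable_bound[OF F_le dc(1) h])
  have "(\<lambda>N. \<Sum>n<N. a n * Beta \<alpha> (\<beta> + 2 * of_nat n)) \<longlonglongrightarrow> integral {0<..<1} F"
    using dc(2) unfolding integral_unique[OF f] .
  then show "(\<lambda>n. a n * Beta \<alpha> (\<beta> + 2 * of_nat n)) sums integral {0<..<1} F"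
    by (simp only: sums_def)
qed

text \<open>Since \<open>x\<close> is positive, powers of \<open>y * x / 2\<close> split without
  branch corrections even for complex \<open>y\<close>. The constants gather in front,
  \<open>x powr w\<close> is left for the Beta kernel, and the series is in even powers of
  \<open>x\<close>.\<close>

lemma k_Bessel_times_of_real:
  fixes k x :: real and v c y :: complex
  assumes "k > 0" "Re (v / of_real k) > -1" "x > 0"
  defines "w \<equiv> v / of_real k" and "X \<equiv> - (c * y\<^sup>2 / (4 * of_real k))"
  shows "k_Bessel k v c (y * of_real x) = (y / 2) powr w / of_real k powr w * (of_real x powr w *
    (\<Sum>n. X ^ n / (Gamma (w + 1 + of_nat n) * fact n) * of_real x ^ (2 * n)))"
proof -
  define a where "a = (\<lambda>n. X ^ n / (Gamma (w + 1 + of_nat n) * fact n))"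
  define C where "C = (y / 2) powr w / of_real k powr w * of_real x powr w"
  have k: "of_real k \<noteq> (0 :: complex)" using assms by simp
  have v: "v = w * of_real k" using k by (simp add: w_def)
  have eq: "(- c) ^ n / (k_Gamma k (of_nat n * of_real k + v + of_real k) * fact n)
      * (y * of_real x / 2) powr (2 * of_nat n + v / of_real k) = C * (a n * of_real x ^ (2 * n))" for n
  \<comment> \<open>For \<open>y = 0\<close> both sides vanish, because \<open>0 powr s = 0\<close>
    for every \<open>s\<close>; this holds even at \<open>w = 0\<close>,
    \<open>n = 0\<close>.\<close>
  proof (cases "y = 0")
    case False
    have "k_Gamma k (of_nat n * of_real k + v + of_real k)
        = of_real k powr (w + of_nat n) * Gamma (w + 1 + of_nat n)"
    proof -
      have "of_nat n * of_real k + v + of_real k = (w + 1 + of_nat n) * of_real k"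
        by (simp add: v algebra_simps)
      moreover have "Re ((w + 1 + of_nat n) * of_real k) > 0"
        using assms by (simp add: w_def)
      ultimately show ?thesis using k_Gamma_eq[OF assms(1)] k by simp
    qed
    moreover have "of_real k powr (w + of_nat n) = of_real k powr w * of_real k ^ n"
      using k by (simp only: powr_add powr_nat' simp_thms)
    moreover have "(y * of_real x / 2) powr (2 * of_nat n + v / of_real k)
        = (y / 2) ^ (2 * n) * of_real x ^ (2 * n) * ((y / 2) powr w * of_real x powr w)"
    proof -
      have y2: "y / 2 \<noteq> 0" and x: "complex_of_real x \<noteq> 0" using False assms by simp_all
      \<comment> \<open>\<open>Ln\<close> is additive when one factor is a positive real, so the
        principal branch is respected.\<close>
      have "(y * of_real x / 2) powr s = (y / 2) powr s * of_real x powr s" for s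
        using Ln_times_of_real[OF assms(3) y2] x y2
        by (simp add: powr_def Ln_of_real assms ring_distribs exp_add mult.commute)
      moreover have "z powr (2 * of_nat n + v / of_real k) = z ^ (2 * n) * z powr w"
        if "z \<noteq> 0" for z :: complex
      proof -
        have "2 * of_nat n + v / of_real k = of_nat (2 * n) + w" by (simp add: w_def)
        then show ?thesis using that by (simp only: powr_add powr_nat' simp_thms)
      qed
      ultimately show ?thesis using x y2 by simp
    qed
    moreover have "X ^ n = (- c) ^ n * (y / 2) ^ (2 * n) / of_real k ^ n"
    proof -
      have "X = (- c) * (y / 2)\<^sup>2 / of_real k" by (simp add: X_def power2_eq_square)
      then show ?thesis by (simp only: power_mult power_mult_distrib power_divide)
    qed
    moreover have "p / (kw * kn * G * f) * (r * t * (yw * xw)) = yw / kw * xw * (p * r / kn / (G * f) * t)"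
      for p kw kn G f r t yw xw :: complex
      by (simp add: divide_inverse mult_ac)
    ultimately show ?thesis
      unfolding C_def a_def by (simp only:)
  qed (simp add: C_def)
  \<comment> \<open>Absorbing \<open>x^2\<close> into \<open>X\<close> makes this an instance of the
    coefficient summability above.\<close>
  have "a n * of_real x ^ (2 * n) = (X * of_real (x\<^sup>2)) ^ n / (Gamma (w + 1 + of_nat n) * fact n)" for n
    by (simp add: a_def power_mult power_mult_distrib)
  then have "summable (\<lambda>n. norm (a n * of_real x ^ (2 * n)))"
    using summable_k_Bessel_coeff[of w "X * of_real (x\<^sup>2)"] assms(2) by (simp add: w_def)
  then have "summable (\<lambda>n. a n * of_real x ^ (2 * n))"
    by (rule summable_norm_cancel)
  from suminf_mult[OF this, of C] show ?thesis
    unfolding k_Bessel_def eq unfolding C_def a_def by (simp only: mult.assoc)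
qed

section \<open>The cubic substitution\<close>

text \<open>The constant \<open>9 / 4\<close> normalises the value at \<open>1\<close> to
  \<open>1\<close>. The derivative vanishes there, so \<open>1 - cubic_subst z\<close> has a double
  root at \<open>1\<close>; its remaining root is \<open>4\<close>.\<close>

definition cubic_subst :: "real \<Rightarrow> real" where "cubic_subst z = 9 / 4 * z * (1 - z / 3)\<^sup>2"

lemma one_minus_cubic_subst: "1 - cubic_subst z = (1 - z / 4) * (1 - z)\<^sup>2"
  by (simp add: cubic_subst_def power2_eq_square field_simps)

lemma cubic_subst_deriv: "(cubic_subst has_real_derivative 9 / 4 * (1 - z) * (1 - z / 3)) (at z within S)"
  unfolding cubic_subst_def
  by (rule derivative_eq_intros refl | simp)+ (simp add: power2_eq_square field_simps)

lemma inj_on_cubic_subst: "inj_on cubic_subst {0<..<1}"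
proof -
  have "cubic_subst x < cubic_subst y" if "0 < x" "x < y" "y < 1" for x y
    using that(2)
  proof (rule DERIV_pos_imp_increasing)
    fix z assume "x \<le> z" "z \<le> y"
    then have "9 / 4 * (1 - z) * (1 - z / 3) > 0" using that by simp
    then show "\<exists>d. (cubic_subst has_real_derivative d) (at z) \<and> d > 0"
      using cubic_subst_deriv by blast
  qed
  then have "strict_mono_on {0<..<1} cubic_subst"
    by (auto simp: strict_mono_on_def)
  then show ?thesis
    by (rule strict_mono_on_imp_inj_on)
qed

lemma cubic_subst_image: "cubic_subst ` {0<..<1} = {0<..<1}"
proof safe
  fix z :: real assume z: "z \<in> {0<..<1}"
  then have "cubic_subst z > 0" "1 - cubic_subst z > 0"
    unfolding one_minus_cubic_subst by (simp_all add: cubic_subst_def)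
  then show "cubic_subst z \<in> {0<..<1}" by simp
next
  fix u :: real assume u: "u \<in> {0<..<1}"
  \<comment> \<open>The endpoint values are \<open>0\<close> and \<open>1\<close>, so a preimage of
    a point of the open interval cannot be an endpoint.\<close>
  have "\<exists>z\<ge>0. z \<le> 1 \<and> cubic_subst z = u"
    using u by (intro IVT') (auto simp: cubic_subst_def power2_eq_square intro!: continuous_intros)
  then obtain z where z: "0 \<le> z" "z \<le> 1" "cubic_subst z = u" by blast
  moreover have "z \<noteq> 0" "z \<noteq> 1"
    using z(3) u by (auto simp: cubic_subst_def power2_eq_square)
  ultimately show "u \<in> cubic_subst ` {0<..<1}" by auto
qed

text \<open>Both sides are compared factor by factor: \<open>1 - z\<close> gets
  \<open>1 + 2 * (lam + w - 1)\<close>, \<open>1 - z / 3\<close> gets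
  \<open>1 + 2 * (\<alpha> - 1)\<close>, \<open>1 - z / 4\<close> gets \<open>lam + w - 1\<close>,
  and \<open>(9 / 4) powr \<alpha>\<close> cancels \<open>(2 / 3) powr (2 * \<alpha>)\<close>.
  \<open>B\<close> and \<open>S\<close> stand for the Bessel prefactor and the value of the
  series.\<close>

lemma Lavoie_Trottier_substitution:
  fixes \<alpha> lam w B S :: complex
  assumes z: "z \<in> {0<..<1}"
  shows "of_real z powr (\<alpha> - 1) * of_real (1 - z) powr (2 * lam - 1)
       * of_real (1 - z / 3) powr (2 * \<alpha> - 1) * of_real (1 - z / 4) powr (lam - 1)
       * (B * (of_real (1 - cubic_subst z) powr w * S))
     = \<bar>9 / 4 * (1 - z) * (1 - z / 3)\<bar> *\<^sub>R (B * (2 / 3) powr (2 * \<alpha>)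
       * (of_real (cubic_subst z) powr (\<alpha> - 1) * of_real (1 - cubic_subst z) powr (lam + w - 1) * S))"
proof -
  have pos: "z > 0" "1 - z > 0" "1 - z / 3 > 0" "1 - z / 4 > 0" "cubic_subst z > 0" "1 - cubic_subst z > 0"
    using z cubic_subst_image by (auto simp: set_eq_iff)
  define q Lz L1 L3 L4 where "q = ln (2 / 3 :: real)" and "Lz = ln z" and "L1 = ln (1 - z)"
    and "L3 = ln (1 - z / 3)" and "L4 = ln (1 - z / 4)"
  \<comment> \<open>\<open>9 / 4\<close> is the power \<open>-2\<close> of \<open>2 / 3\<close>;
    using \<open>q\<close> for both lets the constants cancel inside the exponent.\<close>
  have e: "9 / 4 = exp (- 2 * q)" "z = exp Lz" "1 - z = exp L1" "1 - z / 3 = exp L3" "1 - z / 4 = exp L4"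
    using pos by (simp_all add: q_def Lz_def L1_def L3_def L4_def exp_minus exp_double power2_eq_square)
  have "cubic_subst z = exp (- 2 * q + Lz + 2 * L3)"
    unfolding cubic_subst_def exp_add exp_double[of L3] e(1)[symmetric] e(2)[symmetric] e(4)[symmetric] ..
  then have lnu: "ln (cubic_subst z) = - 2 * q + Lz + 2 * L3" by simp
  have "1 - cubic_subst z = exp (2 * L1 + L4)"
    unfolding one_minus_cubic_subst exp_add exp_double[of L1] e(3)[symmetric] e(5)[symmetric] by (rule mult.commute)
  then have lnu1: "ln (1 - cubic_subst z) = 2 * L1 + L4" by simp
  have g': "\<bar>9 / 4 * (1 - z) * (1 - z / 3)\<bar> = exp (- 2 * q + L1 + L3)"
    unfolding exp_add e(1)[symmetric] e(3)[symmetric] e(4)[symmetric] using pos by simp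
  have q: "(2 / 3 :: complex) powr s = exp (s * of_real q)" for s
    using powr_of_real_eq_exp[of "2 / 3" s] by (simp add: q_def)
  have E: "exp ((\<alpha> - 1) * of_real Lz) * exp ((2 * lam - 1) * of_real L1)
      * exp ((2 * \<alpha> - 1) * of_real L3) * exp ((lam - 1) * of_real L4)
      * exp (w * of_real (2 * L1 + L4))
    = exp (complex_of_real (- 2 * q + L1 + L3)) * exp (2 * \<alpha> * of_real q)
      * exp ((\<alpha> - 1) * of_real (- 2 * q + Lz + 2 * L3)) * exp ((lam + w - 1) * of_real (2 * L1 + L4))"
    unfolding exp_add[symmetric] by (rule arg_cong[of _ _ exp]) (simp add: algebra_simps)
  show ?thesis
    unfolding q powr_of_real_eq_exp[OF pos(1)] powr_of_real_eq_exp[OF pos(2)]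
      powr_of_real_eq_exp[OF pos(3)] powr_of_real_eq_exp[OF pos(4)]
      powr_of_real_eq_exp[OF pos(5)] powr_of_real_eq_exp[OF pos(6)]
      lnu lnu1 g' Lz_def[symmetric] L1_def[symmetric] L3_def[symmetric] L4_def[symmetric]
      scaleR_conv_of_real exp_of_real[symmetric]
    using arg_cong[OF E, of "\<lambda>t. t * (B * S)"] by (simp only: mult_ac)
qed

section \<open>Change of variables and comparison with the Wright series\<close>

theorem theorem2p1:
  fixes k :: real and lam \<rho> v c y :: complex
  assumes "k > 0"
    and "Re (v / of_real k) > -1"
    and "Re (lam + \<rho>) > 0"
    and "Re (lam + v / of_real k) > 0"
  shows "((\<lambda>z::real.
            of_real z powr (lam + \<rho> - 1)
          * of_real (1 - z) powr (2 * lam - 1)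
          * of_real (1 - z / 3) powr (2 * (lam + \<rho>) - 1)
          * of_real (1 - z / 4) powr (lam - 1)
          * k_Bessel k v c (y * of_real (1 - z / 4) * (of_real (1 - z))\<^sup>2))
        has_integral
          ((y / 2) powr (v / of_real k) * Gamma (lam + \<rho>) * (2 / 3) powr (2 * (lam + \<rho>))
            / of_real k powr (v / of_real k)
          * wright_1Psi2 (lam + v / of_real k, 2)
              (v / of_real k + 1, 1) (2 * lam + v / of_real k + \<rho>, 2)
              (- (c * y\<^sup>2 / (4 * of_real k)))))
        {0..1}"
proof -
  define w \<alpha> X where "w = v / of_real k" and "\<alpha> = lam + \<rho>" and "X = - (c * y\<^sup>2 / (4 * of_real k))"
  define a where "a = (\<lambda>n. X ^ n / (Gamma (w + 1 + of_nat n) * fact n))"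
  define B where "B = (y / 2) powr w / of_real k powr w"
  define D where "D = B * (2 / 3) powr (2 * \<alpha>)"
  define F where "F = (\<lambda>u. of_real u powr (\<alpha> - 1) * of_real (1 - u) powr (lam + w - 1)
      * (\<Sum>n. a n * of_real (1 - u) ^ (2 * n)))"
  define K where "K = (\<lambda>z::real. of_real z powr (lam + \<rho> - 1)
          * of_real (1 - z) powr (2 * lam - 1)
          * of_real (1 - z / 3) powr (2 * (lam + \<rho>) - 1)
          * of_real (1 - z / 4) powr (lam - 1)
          * k_Bessel k v c (y * of_real (1 - z / 4) * (of_real (1 - z))\<^sup>2))"
  define W where "W = wright_1Psi2 (lam + w, 2) (w + 1, 1) (2 * lam + w + \<rho>, 2) X"
  have \<alpha>: "Re \<alpha> > 0" and \<beta>: "Re (lam + w) > 0" using assms by (simp_all add: \<alpha>_def w_def)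
  have a: "summable (\<lambda>n. norm (a n))"
    unfolding a_def by (rule summable_k_Bessel_coeff) (use assms in \<open>simp add: w_def\<close>)
  note F = Beta_series_integral[OF \<alpha> \<beta> a, folded F_def]
  have K_eq: "K z = \<bar>9 / 4 * (1 - z) * (1 - z / 3)\<bar> *\<^sub>R (D * F (cubic_subst z))" if z: "z \<in> {0<..<1}" for z
  proof -
    have "1 - cubic_subst z > 0" using z cubic_subst_image by (auto simp: set_eq_iff)
    moreover have "y * of_real (1 - z / 4) * (of_real (1 - z))\<^sup>2 = y * of_real (1 - cubic_subst z)"
      unfolding one_minus_cubic_subst of_real_mult of_real_power by (rule mult.assoc)
    ultimately have "k_Bessel k v c (y * of_real (1 - z / 4) * (of_real (1 - z))\<^sup>2)
        = B * (of_real (1 - cubic_subst z) powr w * (\<Sum>n. a n * of_real (1 - cubic_subst z) ^ (2 * n)))"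
      using k_Bessel_times_of_real[OF assms(1,2), of "1 - cubic_subst z" c y]
      by (simp only: B_def w_def a_def X_def)
    then show ?thesis
      unfolding K_def D_def F_def \<alpha>_def[symmetric]
      by (simp only: Lavoie_Trottier_substitution[OF z])
  qed
  \<comment> \<open>The change of variables theorem transfers absolute integrability and value
    together, so both are supplied for the image of the interval.\<close>
  have DF: "(\<lambda>u. D * F u) absolutely_integrable_on cubic_subst ` {0<..<1} \<and>
      integral (cubic_subst ` {0<..<1}) (\<lambda>u. D * F u) = D * integral {0<..<1} F"
    unfolding cubic_subst_image using F(1) by (auto intro: set_integrable_mult_right)
  have "(\<lambda>z. \<bar>9 / 4 * (1 - z) * (1 - z / 3)\<bar> *\<^sub>R (D * F (cubic_subst z))) absolutely_integrable_on {0<..<1} \<and>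
      integral {0<..<1} (\<lambda>z. \<bar>9 / 4 * (1 - z) * (1 - z / 3)\<bar> *\<^sub>R (D * F (cubic_subst z)))
        = D * integral {0<..<1} F"
    by (rule iffD2[OF has_absolute_integral_change_of_variables_real[OF _ cubic_subst_deriv inj_on_cubic_subst] DF]) simp
  then have "((\<lambda>z. \<bar>9 / 4 * (1 - z) * (1 - z / 3)\<bar> *\<^sub>R (D * F (cubic_subst z))) has_integral
      D * integral {0<..<1} F) {0<..<1}"
    using set_lebesgue_integral_eq_integral(1) by (auto simp: has_integral_iff)
  then have K: "(K has_integral D * integral {0<..<1} F) {0<..<1}"
    by (rule has_integral_eq[rotated]) (simp only: K_eq)
  have "Gamma \<alpha> \<noteq> 0"
    using not_nonpos_Int_of_Re_pos[OF \<alpha>] by (simp add: Gamma_eq_zero_iff)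
  \<comment> \<open>Since \<open>\<alpha> + (lam + w) = 2 * lam + w + \<rho>\<close>, dividing the
    Beta value by \<open>Gamma \<alpha>\<close> leaves exactly the Wright coefficient.\<close>
  then have "a n * Beta \<alpha> (lam + w + 2 * of_nat n) / Gamma \<alpha>
      = Gamma (lam + w + of_real 2 * of_nat n) / (Gamma (w + 1 + of_real 1 * of_nat n)
        * Gamma (2 * lam + w + \<rho> + of_real 2 * of_nat n)) * (X ^ n / fact n)" for n
    by (simp add: a_def Beta_def \<alpha>_def algebra_simps)
  then have "(\<lambda>n. Gamma (lam + w + of_real 2 * of_nat n) / (Gamma (w + 1 + of_real 1 * of_nat n)
        * Gamma (2 * lam + w + \<rho> + of_real 2 * of_nat n)) * (X ^ n / fact n))
      sums (integral {0<..<1} F / Gamma \<alpha>)"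
    using sums_divide[OF F(2), of "Gamma \<alpha>"] by simp
  then have "W = integral {0<..<1} F / Gamma \<alpha>"
    unfolding W_def wright_1Psi2.simps by (rule sums_unique[symmetric])
  then have "integral {0<..<1} F = Gamma \<alpha> * W"
    using \<open>Gamma \<alpha> \<noteq> 0\<close> by simp
  then have val: "D * integral {0<..<1} F
      = (y / 2) powr w * Gamma \<alpha> * (2 / 3) powr (2 * \<alpha>) / of_real k powr w * W"
    by (simp add: D_def B_def)
  \<comment> \<open>Passing from the open to the closed interval makes the values of the integrand
    at \<open>0\<close> and \<open>1\<close>, where some bases vanish, irrelevant.\<close>
  show ?thesis
    using K unfolding val K_def has_integral_Icc_iff_Ioo W_def w_def \<alpha>_def X_def .
qed

end
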